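(* Under the dyadic policy with $N$ questions, for each object $\theta_i$ ($1\le i\le k$) and each binary sequence $s\in\{0,1\}^N$, $$P\left(\theta_i\in C_s\mid B_N\right)=\prod_{j=1}^N\left(\frac{X_j}{k}\right)^{s_j}\left(1-\frac{X_j}{k}\right)^{1-s_j}.$$ Moreover, $$E[\mathcal N(C_s)\mid B_N]=k\,P\left(\theta_1\in C_s\mid B_N\right),$$ where $\mathcal N(C_s)$ denotes the number of objects (indices $i\in\{1,\dots,k\}$ with $\theta_i\in C_s$) located in the set $C_s$.
   Context: Let $k\ge1$, $N\ge1$ be integers. $\theta=(\theta_1,\dots,\theta_k)$ is a random vector in $\mathbb R^k$ whose coordinates ("objects") are i.i.d. with Lebesgue density $f_0$ on $\mathbb R$ having finite differential entropy. $Z$ is uniform on $[0,1]$ and independent of $\theta$. Dyadic policy: let $F_0$ be the cumulative distribution function of $f_0$, $Q(p)=\inf\{u\in\mathbb R:p\le F_0(u)\}$ for $p\in[0,1]$ (possibly $\pm\infty$ at $p=0,1$), $\mathrm{supp}(f_0)=\{u:f_0(u)>0\}$, and for each $n\ge1$ let $A_n=\left(\bigcup_{j=1}^{2^{n-1}}\left(Q\left(\frac{2j-1}{2^n}\right),Q\left(\frac{2j}{2^n}\right)\right]\right)\cap\mathrm{supp}(f_0)$. The answer to the $n$-th question is $X_n=\sum_{i=1}^k\mathbb 1_{A_n}(\theta_i)$, and the history is $B_N=(Z,A_1,\dots,A_N,X_1,\dots,X_N)$ (the $A_n$ are deterministic). For $s=(s_1,\dots,s_N)\in\{0,1\}^N$,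 $C_s=\left(\bigcap_{j:s_j=1}A_j\right)\cap\left(\bigcap_{j:s_j=0}A_j^c\right)\cap\mathrm{supp}(f_0)$. Convention: $0^0=1$. *)

theory Defs
  imports "HOL-Probability.Probability"
begin

definition quantile :: "(real \<Rightarrow> real) \<Rightarrow> real \<Rightarrow> ereal" where
  "quantile f p = Inf (ereal ` {u. p \<le> cdf (density lborel f) u})"

definition support :: "(real \<Rightarrow> real) \<Rightarrow> real set" where
  "support f = {u. f u > 0}"

text \<open>Only used for \<open>n \<ge> 1\<close>. The endpoints are extended reals, so that the outermost
  intervals may be unbounded; the sets themselves consist of reals.\<close>

definition dyadic_query :: "(real \<Rightarrow> real) \<Rightarrow> nat \<Rightarrow> real set" where
  "dyadic_query f n =
     (\<Union>j\<in>{1..2 ^ (n - 1) :: nat}.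
        {u. quantile f ((2 * real j - 1) / 2 ^ n) < ereal u \<and>
            ereal u \<le> quantile f (2 * real j / 2 ^ n)}) \<inter> support f"

definition answer :: "(nat \<Rightarrow> 'a \<Rightarrow> real) \<Rightarrow> nat \<Rightarrow> (nat \<Rightarrow> real set) \<Rightarrow> nat \<Rightarrow> 'a \<Rightarrow> nat" where
  "answer \<theta> k A n \<omega> = (\<Sum>i\<in>{1..k}. indicator (A n) (\<theta> i \<omega>))"

definition cell :: "(real \<Rightarrow> real) \<Rightarrow> nat \<Rightarrow> (nat \<Rightarrow> nat) \<Rightarrow> real set" where
  "cell f N s =
     (\<Inter>j\<in>{j\<in>{1..N}. s j = 1}. dyadic_query f j) \<inter>
     (\<Inter>j\<in>{j\<in>{1..N}. s j = 0}. - dyadic_query f j) \<inter> support f"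

definition num_objects :: "(nat \<Rightarrow> 'a \<Rightarrow> real) \<Rightarrow> nat \<Rightarrow> real set \<Rightarrow> 'a \<Rightarrow> nat" where
  "num_objects \<theta> k C \<omega> = card {i\<in>{1..k}. \<theta> i \<omega> \<in> C}"

definition history ::
    "('a \<Rightarrow> real) \<Rightarrow> (nat \<Rightarrow> 'a \<Rightarrow> real) \<Rightarrow> nat \<Rightarrow> (nat \<Rightarrow> real set) \<Rightarrow> nat \<Rightarrow> 'a \<Rightarrow>
     real \<times> (nat \<Rightarrow> real set) \<times> (nat \<Rightarrow> nat)" where
  "history Z \<theta> k A N \<omega> =
     (Z \<omega>, (\<lambda>n\<in>{1..N}. A n), (\<lambda>n\<in>{1..N}. answer \<theta> k A n \<omega>))"

text \<open>The questions \<open>A n\<close> do not depend on the outcome, so their component of the history is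
  constant and the choice of \<open>\<sigma>\<close>-algebra on sets of reals is immaterial.\<close>

definition history_space :: "nat \<Rightarrow> (real \<times> (nat \<Rightarrow> real set) \<times> (nat \<Rightarrow> nat)) measure" where
  "history_space N =
     borel \<Otimes>\<^sub>M (Pi\<^sub>M {1..N} (\<lambda>_. count_space UNIV) \<Otimes>\<^sub>M Pi\<^sub>M {1..N} (\<lambda>_. count_space UNIV))"

text \<open>Independence of two random variables with possibly different value types, which
  \<^const>\<open>prob_space.indep_var\<close> does not cover.\<close>

definition indep_rv ::
    "'a measure \<Rightarrow> 'b measure \<Rightarrow> ('a \<Rightarrow> 'b) \<Rightarrow> 'c measure \<Rightarrow> ('a \<Rightarrow> 'c) \<Rightarrow> bool" where
  "indep_rv M S X T Y \<longleftrightarrow>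
     X \<in> measurable M S \<and> Y \<in> measurable M T \<and>
     prob_space.indep_set M (sets (vimage_algebra (space M) X S))
                            (sets (vimage_algebra (space M) Y T))"

definition cond_expect_given ::
    "'a measure \<Rightarrow> 'b measure \<Rightarrow> ('a \<Rightarrow> 'b) \<Rightarrow> ('a \<Rightarrow> real) \<Rightarrow> 'a \<Rightarrow> real" where
  "cond_expect_given M S B Y = real_cond_exp M (vimage_algebra (space M) B S) Y"

definition cond_prob_given ::
    "'a measure \<Rightarrow> 'b measure \<Rightarrow> ('a \<Rightarrow> 'b) \<Rightarrow> 'a set \<Rightarrow> 'a \<Rightarrow> real" where
  "cond_prob_given M S B E = cond_expect_given M S B (indicator E)"

end

theory Submission
  imports Defs "HOL-Combinatorics.Transposition"
begin

text \<open>
  The cumulative distribution function of an atomless law maps it to the uniform distribution, and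
  up to a null set the \<open>n\<close>-th dyadic query asks for the \<open>n\<close>-th binary digit. Hence the incidence
  relation between queries and objects is uniformly distributed over all relations and independent
  of \<open>Z\<close>. Swapping, in each row \<open>j\<close> of this relation, object \<open>i\<close> with another object \<open>c j\<close>
  preserves its law and all answers, so given the history the event that object \<open>i\<close> has digits \<open>s\<close>
  is as likely as the event that, for every \<open>j\<close>, object \<open>c j\<close> has \<open>j\<close>-th digit \<open>s j\<close>. Averaging
  over all choice functions \<open>c\<close>, the product over \<open>j\<close> factors into the proportions
  \<open>X j / k\<close> and \<open>1 - X j / k\<close>.
\<close>

section \<open>The probability integral transform\<close>

text \<open>Without atoms the cdf is continuous, so each level \<open>r\<close> strictly between 0
  and 1 is attained at some \<open>q\<close>. Comparison with \<open>{..q}\<close>, which has mass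
  \<open>r\<close>, bounds the strict sublevel set from above and the weak one from below. Letting
  \<open>r\<close> tend to \<open>p\<close> from either side squeezes both masses to
  \<open>p\<close>, also at the endpoints 0 and 1.\<close>

lemma (in real_distribution) atomless_prob_cdf:
  assumes atomless: "\<And>x. prob {x} = 0" and p: "0 \<le> p" "p \<le> 1"
  shows "prob {u. cdf M u \<le> p} = p" and "prob {u. cdf M u < p} = p"
proof -
  have cont: "isCont (cdf M) x" for x
    by (simp add: isCont_cdf atomless)
  have [measurable]: "cdf M \<in> borel_measurable M"
    using cont by (simp add: borel_measurable_continuous_onI continuous_at_imp_continuous_on
        cong: measurable_cong_sets)
  have meas: "{u. cdf M u \<le> r} \<in> events" "{u. cdf M u < r} \<in> events" for r
  proof -
    have "{u \<in> space M. cdf M u \<le> r} \<in> events" "{u \<in> space M. cdf M u < r} \<in> events"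
      by measurable
    then show "{u. cdf M u \<le> r} \<in> events" "{u. cdf M u < r} \<in> events"
      by simp_all
  qed
  have attained: "\<exists>q. cdf M q = r" if "0 < r" "r < 1" for r
  proof -
    obtain b where b: "r < cdf M b"
      using order_tendstoD(1)[OF cdf_lim_at_top_prob \<open>r < 1\<close>]
      by (meson eventually_happens trivial_limit_at_top_linorder)
    obtain a where a: "cdf M a < r"
      using order_tendstoD(2)[OF cdf_lim_at_bot \<open>0 < r\<close>]
      by (meson eventually_happens trivial_limit_at_bot_linorder)
    have "a \<le> b"
      using a b cdf_nondecreasing[of b a] by linarith
    then show ?thesis
      using IVT'[of "cdf M" a r b] a b cont by (force intro: continuous_at_imp_continuous_on)
  qed
  have less_le: "prob {u. cdf M u < r} \<le> r" and le_ge: "r \<le> prob {u. cdf M u \<le> r}"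
    if r: "0 < r" "r < 1" for r
  proof -
    obtain q where q: "cdf M q = r"
      using attained r by blast
    have "u \<le> q" if "cdf M u < r" for u
      using that q cdf_nondecreasing[of q u] by linarith
    then have "prob {u. cdf M u < r} \<le> prob {..q}"
      by (intro finite_measure_mono) auto
    then show "prob {u. cdf M u < r} \<le> r"
      using q by (simp add: cdf_def)
    have "prob {..q} \<le> prob {u. cdf M u \<le> r}"
      using q meas by (intro finite_measure_mono) (auto simp: cdf_nondecreasing)
    then show "r \<le> prob {u. cdf M u \<le> r}"
      using q by (simp add: cdf_def)
  qed
  have mono: "prob {u. cdf M u < p} \<le> prob {u. cdf M u \<le> p}"
    using meas by (intro finite_measure_mono) auto
  have "prob {u. cdf M u \<le> p} \<le> p"
  proof (cases "p = 1")
    case False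
    show ?thesis
    proof (rule dense_ge_bounded)
      show "p < 1" using False p by simp
      fix r assume "p < r" "r < 1"
      then have "prob {u. cdf M u \<le> p} \<le> prob {u. cdf M u < r}"
        using meas by (intro finite_measure_mono) auto
      also have "\<dots> \<le> r"
        using less_le \<open>p < r\<close> \<open>r < 1\<close> p by simp
      finally show "prob {u. cdf M u \<le> p} \<le> r" .
    qed
  qed simp
  moreover have "p \<le> prob {u. cdf M u < p}"
  proof (cases "p = 0")
    case False
    show ?thesis
    proof (rule dense_le_bounded)
      show "0 < p" using False p by simp
      fix r assume "0 < r" "r < p"
      then have "r \<le> prob {u. cdf M u \<le> r}"
        using le_ge p by simp
      also have "\<dots> \<le> prob {u. cdf M u < p}"
        using meas \<open>r < p\<close> by (intro finite_measure_mono) auto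
      finally show "r \<le> prob {u. cdf M u < p}" .
    qed
  qed simp
  ultimately show "prob {u. cdf M u \<le> p} = p" "prob {u. cdf M u < p} = p"
    using mono by auto
qed

section \<open>Binary digits and quantile intervals\<close>

text \<open>Horner's scheme with \<open>d 1\<close> as the most significant digit, in keeping with
  the first question asking for the leading binary digit.\<close>

primrec digits_value :: "(nat \<Rightarrow> bool) \<Rightarrow> nat \<Rightarrow> int" where
  "digits_value d 0 = 0"
| "digits_value d (Suc n) = 2 * digits_value d n + of_bool (d (Suc n))"

lemma digits_value_bounds: "0 \<le> digits_value d n \<and> digits_value d n < 2 ^ n"
  by (induction n) auto

text \<open>Halving the floor at stage \<open>Suc n\<close> gives the floor at stage
  \<open>n\<close>, so each new parity appends one digit. A whole pattern of digits thus confines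
  \<open>g\<close> to a single dyadic interval of length \<open>1 / 2 ^ n\<close>.\<close>

lemma binary_digits_iff:
  fixes g :: real
  assumes "0 \<le> g" "g < 1"
  shows "(\<forall>j\<in>{1..n}. odd \<lfloor>2 ^ j * g\<rfloor> \<longleftrightarrow> d j) \<longleftrightarrow> \<lfloor>2 ^ n * g\<rfloor> = digits_value d n"
proof (induction n)
  case 0
  then show ?case
    using assms by (simp add: floor_eq_iff)
next
  case (Suc n)
  have half: "\<lfloor>2 ^ Suc n * g\<rfloor> div 2 = \<lfloor>2 ^ n * g\<rfloor>"
    using floor_divide_real_eq_div[of 2 "2 ^ Suc n * g"] by simp
  have "(\<forall>j\<in>{1..Suc n}. odd \<lfloor>2 ^ j * g\<rfloor> \<longleftrightarrow> d j) \<longleftrightarrow>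
      (\<forall>j\<in>{1..n}. odd \<lfloor>2 ^ j * g\<rfloor> \<longleftrightarrow> d j) \<and> (odd \<lfloor>2 ^ Suc n * g\<rfloor> \<longleftrightarrow> d (Suc n))"
    by (auto simp: atLeastAtMostSuc_conv)
  also have "\<dots> \<longleftrightarrow> \<lfloor>2 ^ Suc n * g\<rfloor> div 2 = digits_value d n \<and> (odd \<lfloor>2 ^ Suc n * g\<rfloor> \<longleftrightarrow> d (Suc n))"
    using Suc.IH half by simp
  also have "\<dots> \<longleftrightarrow> \<lfloor>2 ^ Suc n * g\<rfloor> = digits_value d (Suc n)"
    by (cases "d (Suc n)") (simp_all, presburger+)
  finally show ?case .
qed

lemma le_quantileI:
  assumes "cdf (density lborel f) u < p" "real_distribution (density lborel f)"
  shows "ereal u \<le> quantile f p"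
proof -
  interpret real_distribution "density lborel f" by fact
  show ?thesis
    unfolding quantile_def
  proof (rule Inf_greatest, clarsimp)
    fix v assume "p \<le> cdf (density lborel f) v"
    then show "u \<le> v"
      using assms(1) cdf_nondecreasing[of v u] by linarith
  qed
qed

text \<open>Continuity leaves room to the left of \<open>u\<close>: some \<open>v < u\<close> still
  has cdf above \<open>p\<close>, and the infimum is at most \<open>v\<close>.\<close>

lemma quantile_lessI:
  assumes "p < cdf (density lborel f) u" "isCont (cdf (density lborel f)) u"
  shows "quantile f p < ereal u"
proof -
  have "\<forall>\<^sub>F v in at_left u. p < cdf (density lborel f) v"
    using assms by (intro order_tendstoD(1)) (auto simp: isCont_def filterlim_at_split)
  moreover have "\<forall>\<^sub>F v in at_left u. v < u"
    by (simp add: eventually_at_filter)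
  ultimately have "\<forall>\<^sub>F v in at_left u. p < cdf (density lborel f) v \<and> v < u"
    by (rule eventually_conj)
  then obtain v where "p < cdf (density lborel f) v" "v < u"
    using eventually_happens'[OF trivial_limit_at_left_real] by blast
  then have "quantile f p \<le> ereal v"
    unfolding quantile_def by (intro Inf_lower) auto
  then show ?thesis
    using \<open>v < u\<close> by (simp add: le_less_trans)
qed

text \<open>Away from dyadic levels, \<open>u\<close> compares with a quantile exactly as its cdf
  value \<open>g\<close> compares with the level. The \<open>j\<close>-th interval then says that
  \<open>2 ^ n * g\<close> lies between \<open>2 * j - 1\<close> and \<open>2 * j\<close>, that is,
  its floor is the odd number \<open>2 * j - 1\<close>.\<close>

lemma dyadic_query_iff:
  assumes "real_distribution (density lborel f)"
    and cont: "\<And>x. isCont (cdf (density lborel f)) x"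
    and generic: "\<And>j. cdf (density lborel f) u \<noteq> real j / 2 ^ n"
    and "f u > 0" "n \<ge> 1"
  shows "u \<in> dyadic_query f n \<longleftrightarrow> odd \<lfloor>2 ^ n * cdf (density lborel f) u\<rfloor>"
proof -
  interpret real_distribution "density lborel f" by fact
  define g where "g = cdf (density lborel f) u"
  have trichotomy: "real j / 2 ^ n < g \<and> quantile f (real j / 2 ^ n) < ereal u \<or>
      g < real j / 2 ^ n \<and> ereal u \<le> quantile f (real j / 2 ^ n)" for j
  proof (cases "real j / 2 ^ n < g")
    case True
    then show ?thesis
      unfolding g_def using quantile_lessI[OF _ cont] by blast
  next
    case False
    then have "g < real j / 2 ^ n"
      using generic[of j] unfolding g_def by linarith
    then show ?thesis
      unfolding g_def using le_quantileI[OF _ assms(1)] by blast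
  qed
  have gt: "quantile f (real j / 2 ^ n) < ereal u \<longleftrightarrow> real j / 2 ^ n < g" for j
    using trichotomy[of j] leD less_asym by metis
  have le: "ereal u \<le> quantile f (real j / 2 ^ n) \<longleftrightarrow> g < real j / 2 ^ n" for j
    using trichotomy[of j] leD less_asym by metis
  \<comment> \<open>The instance \<open>j = 2 ^ n\<close> of \<open>generic\<close> rules out
    \<open>g = 1\<close>.\<close>
  have g01: "0 \<le> g" "g < 1"
    using cdf_nonneg[of u] cdf_bounded_prob[of u] generic[of "2 ^ n"] by (simp_all add: g_def)
  have two: "(2 ^ n :: nat) = 2 * 2 ^ (n - 1)"
    using \<open>n \<ge> 1\<close> by (simp flip: power_Suc)
  have "u \<in> dyadic_query f n \<longleftrightarrow>
      (\<exists>j\<in>{1..2 ^ (n - 1) :: nat}. real (2 * j - 1) / 2 ^ n < g \<and> g < real (2 * j) / 2 ^ n)"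
    unfolding gt[symmetric] le[symmetric] dyadic_query_def support_def
    using \<open>f u > 0\<close> by (simp add: of_nat_diff)
  also have "\<dots> \<longleftrightarrow> odd \<lfloor>2 ^ n * g\<rfloor>"
  proof
    assume "\<exists>j\<in>{1..2 ^ (n - 1) :: nat}. real (2 * j - 1) / 2 ^ n < g \<and> g < real (2 * j) / 2 ^ n"
    then obtain j :: nat where "j \<ge> 1" "real (2 * j - 1) / 2 ^ n < g" "g < real (2 * j) / 2 ^ n"
      by auto
    then have "\<lfloor>2 ^ n * g\<rfloor> = 2 * int j - 1"
      by (intro floor_unique) (auto simp: field_simps of_nat_diff)
    then show "odd \<lfloor>2 ^ n * g\<rfloor>" by simp
  next
    assume "odd \<lfloor>2 ^ n * g\<rfloor>"
    moreover have nonneg: "0 \<le> \<lfloor>2 ^ n * g\<rfloor>" using g01 by simp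
    ultimately obtain l where l: "nat \<lfloor>2 ^ n * g\<rfloor> = 2 * l + 1"
      by (metis oddE even_nat_iff)
    then have fl: "\<lfloor>2 ^ n * g\<rfloor> = 2 * int l + 1" using nonneg by linarith
    have "2 ^ n * g < 2 ^ n" using g01 by simp
    then have "\<lfloor>2 ^ n * g\<rfloor> < 2 ^ n" by (simp add: floor_less_iff)
    then have "2 * l + 1 < 2 ^ n"
      using fl by (simp flip: of_nat_less_iff[where 'a = int])
    \<comment> \<open>The intervals are numbered from 1, so the floor \<open>2 * l + 1\<close>
      belongs to the one with index \<open>Suc l\<close>.\<close>
    then have "Suc l \<in> {1..2 ^ (n - 1)}" using two by simp
    moreover have "real (2 * Suc l - 1) / 2 ^ n < g" "g < real (2 * Suc l) / 2 ^ n"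
    proof -
      have "real (2 * l + 1) \<le> 2 ^ n * g" "2 ^ n * g < real (2 * l + 2)"
        using fl by (simp_all add: floor_eq_iff)
      \<comment> \<open>The floor gives only a weak inequality on the left; genericity makes it
        strict.\<close>
      moreover have "real (2 * l + 1) \<noteq> 2 ^ n * g"
        using generic[of "2 * l + 1"] by (auto simp: field_simps g_def)
      ultimately show "g < real (2 * Suc l) / 2 ^ n" "real (2 * Suc l - 1) / 2 ^ n < g"
        by (simp_all add: field_simps)
    qed
    ultimately show "\<exists>j\<in>{1..2 ^ (n - 1) :: nat}. real (2 * j - 1) / 2 ^ n < g \<and> g < real (2 * j) / 2 ^ n"
      by blast
  qed
  finally show ?thesis by (simp add: g_def)
qed

lemma borel_dyadic_query:
  assumes [measurable]: "f \<in> borel_measurable borel"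
  shows "dyadic_query f n \<in> sets borel"
proof -
  have "{u. q < ereal u \<and> ereal u \<le> q'} \<in> sets borel" for q q'
    by measurable
  moreover have "support f \<in> sets borel"
    unfolding support_def by measurable
  ultimately show ?thesis
    unfolding dyadic_query_def by (intro sets.Int sets.finite_UN) auto
qed

text \<open>Almost surely the density is positive and the cdf value is not dyadic, so the pattern
  says that this value lies in one half-open dyadic interval. The uniform law gives that interval
  its length as mass.\<close>

lemma measure_dyadic_pattern:
  fixes f :: "real \<Rightarrow> real"
  assumes "real_distribution (density lborel f)"
    and f[measurable]: "f \<in> borel_measurable borel"
  shows "measure (density lborel f) {u. \<forall>j\<in>{1..N}. u \<in> dyadic_query f j \<longleftrightarrow> d j} = 1 / 2 ^ N"
proof -
  define \<mu> where "\<mu> = density lborel (\<lambda>x. ennreal (f x))"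
  interpret real_distribution \<mu> using assms(1) by (simp add: \<mu>_def)
  note [measurable] = borel_dyadic_query[OF f]
  have "emeasure \<mu> {x} = 0" for x
  proof -
    have "AE y in lborel. y \<noteq> x" by (rule AE_lborel_singleton)
    then have "(\<integral>\<^sup>+y. ennreal (f y) * indicator {x} y \<partial>lborel) = 0"
      by (subst nn_integral_0_iff_AE) (auto simp: indicator_def)
    then show ?thesis by (simp add: \<mu>_def emeasure_density)
  qed
  then have atomless: "prob {x} = 0" for x by (simp add: measure_def)
  then have cont: "isCont (cdf \<mu>) x" for x by (simp add: isCont_cdf)
  have [measurable]: "cdf \<mu> \<in> borel_measurable borel"
    using cont by (simp add: borel_measurable_continuous_onI continuous_at_imp_continuous_on)
  note uniform = atomless_prob_cdf[OF atomless]
  \<comment> \<open>A level set of the cdf can be a whole interval, so its mass is computed as the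
    difference of the two masses in \<open>uniform\<close>, which agree.\<close>
  have not_hit: "AE u in \<mu>. cdf \<mu> u \<noteq> p" for p
  proof (cases "0 \<le> p \<and> p \<le> 1")
    case True
    have "prob ({u. cdf \<mu> u < p} \<union> {u. cdf \<mu> u = p}) =
        prob {u. cdf \<mu> u < p} + prob {u. cdf \<mu> u = p}"
      by (intro finite_measure_Union) auto
    also have "{u. cdf \<mu> u < p} \<union> {u. cdf \<mu> u = p} = {u. cdf \<mu> u \<le> p}" by auto
    finally have "prob {u. cdf \<mu> u = p} = 0" using uniform True by simp
    then show ?thesis
      by (intro AE_I[of _ _ "{u. cdf \<mu> u = p}"]) (auto simp: emeasure_eq_measure)
  next
    case False
    then show ?thesis
      by (intro AE_I2) (metis cdf_nonneg cdf_bounded_prob)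
  qed
  have "AE u in \<mu>. \<forall>j n. cdf \<mu> u \<noteq> real j / 2 ^ n"
    using not_hit by (simp add: AE_all_countable)
  moreover have "AE u in \<mu>. f u > 0"
    unfolding \<mu>_def by (subst AE_density) auto
  ultimately have pattern: "AE u in \<mu>. (\<forall>j\<in>{1..N}. u \<in> dyadic_query f j \<longleftrightarrow> d j) \<longleftrightarrow>
      \<lfloor>2 ^ N * cdf \<mu> u\<rfloor> = digits_value d N"
  proof eventually_elim
    case (elim u)
    \<comment> \<open>The value 1 is the dyadic number \<open>1 / 2 ^ 0\<close>.\<close>
    have "cdf \<mu> u \<noteq> 1" using elim(1)[rule_format, of 1 0] by simp
    then have g: "0 \<le> cdf \<mu> u" "cdf \<mu> u < 1"
      using cdf_nonneg[of u] cdf_bounded_prob[of u] by simp_all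
    have "u \<in> dyadic_query f j \<longleftrightarrow> odd \<lfloor>2 ^ j * cdf \<mu> u\<rfloor>" if "j \<in> {1..N}" for j
      using dyadic_query_iff[of f u j] assms(1) cont elim that by (simp add: \<mu>_def)
    then show ?case using binary_digits_iff[OF g, of N d] by auto
  qed
  let ?m = "digits_value d N"
  have m: "0 \<le> ?m" "?m + 1 \<le> 2 ^ N" using digits_value_bounds[of d N] by auto
  \<comment> \<open>This keeps the upper threshold \<open>(?m + 1) / 2 ^ N\<close> within the unit
    interval, where \<open>uniform\<close> applies.\<close>
  have le1: "real_of_int (?m + 1) \<le> 2 ^ N"
    using m(2) by (metis of_int_le_iff of_int_numeral of_int_power)
  have "prob {u. \<forall>j\<in>{1..N}. u \<in> dyadic_query f j \<longleftrightarrow> d j} = prob {u. \<lfloor>2 ^ N * cdf \<mu> u\<rfloor> = ?m}"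
    using pattern by (intro finite_measure_eq_AE) auto
  also have "{u. \<lfloor>2 ^ N * cdf \<mu> u\<rfloor> = ?m} =
      {u. cdf \<mu> u < (?m + 1) / 2 ^ N} - {u. cdf \<mu> u < ?m / 2 ^ N}"
    by (auto simp: floor_eq_iff field_simps)
  also have "prob \<dots> = prob {u. cdf \<mu> u < (?m + 1) / 2 ^ N} - prob {u. cdf \<mu> u < ?m / 2 ^ N}"
    by (intro finite_measure_Diff) (auto simp: field_simps)
  also have "\<dots> = (?m + 1) / 2 ^ N - ?m / 2 ^ N"
    using m le1 by (subst (1 2) uniform(2)) auto
  also have "\<dots> = 1 / 2 ^ N" by (simp add: field_simps)
  finally show ?thesis by (simp add: \<mu>_def)
qed

section \<open>Averaging over incidence relations\<close>

text \<open>The weight sees only the row counts, so the left side does not change when in each row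
  \<open>j\<close> the object \<open>i\<close> is replaced by any \<open>c j\<close>. Averaging over
  all choice functions \<open>c\<close> and factoring over the rows gives the right side.\<close>

lemma sum_Pow_row_average:
  fixes w :: "('j \<Rightarrow> nat) \<Rightarrow> real"
  assumes fin: "finite J" "finite K" and i: "i \<in> K"
  defines "x \<equiv> \<lambda>m. \<lambda>j\<in>J. card {i'\<in>K. (j, i') \<in> m}"
  shows "(\<Sum>m\<in>Pow (J \<times> K). w (x m) * (\<Prod>j\<in>J. of_bool ((j, i) \<in> m \<longleftrightarrow> d j))) =
    (\<Sum>m\<in>Pow (J \<times> K). w (x m) *
      (\<Prod>j\<in>J. (\<Sum>i'\<in>K. of_bool ((j, i') \<in> m \<longleftrightarrow> d j)) / real (card K)))"
    (is "?L = ?R")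
proof -
  have swap: "(\<Sum>m\<in>Pow (J \<times> K). w (x m) * (\<Prod>j\<in>J. of_bool ((j, c j) \<in> m \<longleftrightarrow> d j))) = ?L"
    if c: "c \<in> J \<rightarrow>\<^sub>E K" for c
  proof -
    \<comment> \<open>Row \<open>j\<close> is permuted by the transposition of \<open>i\<close> and
      \<open>c j\<close>. This is an involution on relations, so \<open>h\<close> serves as its own
      inverse in the reindexing below.\<close>
    define h where "h m = {(j, i') \<in> J \<times> K. (j, Transposition.transpose i (c j) i') \<in> m}" for m
    have tK: "Transposition.transpose i (c j) i' \<in> K" if "j \<in> J" "i' \<in> K" for j i'
      using that c i by (auto simp: Transposition.transpose_def)
    have hh: "h (h m) = m" if "m \<subseteq> J \<times> K" for m
      using that tK by (auto simp: h_def)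
    have xh: "x (h m) = x m" for m
      unfolding x_def
    proof (rule restrict_ext)
      fix j assume j: "j \<in> J"
      have "bij_betw (Transposition.transpose i (c j)) {i'\<in>K. (j, i') \<in> h m} {i'\<in>K. (j, i') \<in> m}"
        using j tK by (intro bij_betw_byWitness[where f' = "Transposition.transpose i (c j)"]) (auto simp: h_def)
      then show "card {i'\<in>K. (j, i') \<in> h m} = card {i'\<in>K. (j, i') \<in> m}"
        by (rule bij_betw_same_card)
    qed
    have mem: "(j, i) \<in> h m \<longleftrightarrow> (j, c j) \<in> m" if "j \<in> J" for j m
      using that i by (auto simp: h_def)
    show ?thesis
      by (rule sum.reindex_bij_witness[of _ h h]) (auto simp: hh xh mem, auto simp: h_def)
  qed
  \<comment> \<open>Distributivity turns the product over rows of sums over objects into a sum over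
    choice functions.\<close>
  have "?R = (\<Sum>m\<in>Pow (J \<times> K). \<Sum>c\<in>J \<rightarrow>\<^sub>E K.
      w (x m) * (\<Prod>j\<in>J. of_bool ((j, c j) \<in> m \<longleftrightarrow> d j)) / real (card K) ^ card J)"
    by (simp only: prod_dividef prod_sum_PiE[OF fin(1) fin(2)] prod_constant sum_distrib_left
        sum_divide_distrib times_divide_eq_right)
  also have "\<dots> = (\<Sum>c\<in>J \<rightarrow>\<^sub>E K. ?L / real (card K) ^ card J)"
    by (subst sum.swap, rule sum.cong) (simp_all add: swap flip: sum_divide_distrib)
  \<comment> \<open>There are \<open>card K ^ card J\<close> choice functions, a nonzero number
    because \<open>i\<close> lies in \<open>K\<close>.\<close>
  also have "\<dots> = ?L"
    using fin i by (auto simp: card_PiE)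
  finally show ?thesis by simp
qed

section \<open>The law of the incidence relation\<close>

text \<open>The array of all digits of all objects, coded as a set of pairs. For finite
  \<open>J\<close> and \<open>K\<close> it takes finitely many values, which reduces expectations to
  finite sums.\<close>

definition hits :: "('j \<Rightarrow> 'b set) \<Rightarrow> 'j set \<Rightarrow> 'i set \<Rightarrow> ('i \<Rightarrow> 'a \<Rightarrow> 'b) \<Rightarrow> 'a \<Rightarrow> ('j \<times> 'i) set" where
  "hits A J K \<theta> \<omega> = {(j, i) \<in> J \<times> K. \<theta> i \<omega> \<in> A j}"

lemma hits_eq_iff:
  assumes "m \<subseteq> J \<times> K"
  shows "hits A J K \<theta> \<omega> = m \<longleftrightarrow> (\<forall>i\<in>K. \<forall>j\<in>J. \<theta> i \<omega> \<in> A j \<longleftrightarrow> (j, i) \<in> m)"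
  using assms by (auto simp: hits_def set_eq_iff)

lemma measurable_hits:
  assumes fin: "finite J" "finite K"
    and [measurable]: "\<And>i. i \<in> K \<Longrightarrow> \<theta> i \<in> measurable M S" "\<And>j. j \<in> J \<Longrightarrow> A j \<in> sets S"
  shows "hits A J K \<theta> \<in> measurable M (count_space (Pow (J \<times> K)))"
proof -
  have "hits A J K \<theta> -` {m} \<inter> space M \<in> sets M" if "m \<subseteq> J \<times> K" for m
  proof -
    have "hits A J K \<theta> -` {m} \<inter> space M =
        {\<omega>\<in>space M. \<forall>i\<in>K. \<forall>j\<in>J. \<theta> i \<omega> \<in> A j \<longleftrightarrow> (j, i) \<in> m}"
      using hits_eq_iff[OF that, of A \<theta>] by auto
    also have "\<dots> \<in> sets M"
      using fin by measurable
    finally show ?thesis .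
  qed
  then show ?thesis
    using fin by (auto simp: measurable_count_space_eq2 hits_def)
qed

text \<open>Fixing the relation prescribes one column per object. The columns are independent of
  each other and of \<open>Z\<close>, and each has the same probability \<open>c\<close>. As the
  value is the same for every \<open>m\<close>, the relation is uniform and independent of
  \<open>Z\<close>.\<close>

lemma (in prob_space) prob_indep_hits:
  assumes fin: "finite J" "finite K" "K \<noteq> {}"
    and indep: "indep_vars (\<lambda>_. S) \<theta> K"
    and A[measurable]: "\<And>j. j \<in> J \<Longrightarrow> A j \<in> sets S"
    and c: "\<And>i d. i \<in> K \<Longrightarrow> prob {\<omega>\<in>space M. \<forall>j\<in>J. \<theta> i \<omega> \<in> A j \<longleftrightarrow> d j} = c"
    and Z: "indep_rv M T Z (Pi\<^sub>M K (\<lambda>_. S)) (\<lambda>\<omega>. \<lambda>i\<in>K. \<theta> i \<omega>)"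
    and E: "E \<in> sets T" and m: "m \<subseteq> J \<times> K"
  shows "prob {\<omega>\<in>space M. Z \<omega> \<in> E \<and> hits A J K \<theta> \<omega> = m} =
    prob {\<omega>\<in>space M. Z \<omega> \<in> E} * c ^ card K"
proof -
  define G where "G i = {u\<in>space S. \<forall>j\<in>J. u \<in> A j \<longleftrightarrow> (j, i) \<in> m}" for i
  have G: "G i \<in> sets S" for i
    unfolding G_def using fin by measurable
  have rv: "\<theta> i \<omega> \<in> space S" if "i \<in> K" "\<omega> \<in> space M" for i \<omega>
    using indep that by (auto simp: indep_vars_def dest: measurable_space)
  have hits: "hits A J K \<theta> \<omega> = m \<longleftrightarrow> (\<forall>i\<in>K. \<theta> i \<omega> \<in> G i)" if "\<omega> \<in> space M" for \<omega>
    using rv that by (auto simp: hits_eq_iff[OF m] G_def)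
  let ?V = "\<lambda>\<omega>. \<lambda>i\<in>K. \<theta> i \<omega>"
  have eq: "{\<omega>\<in>space M. Z \<omega> \<in> E \<and> hits A J K \<theta> \<omega> = m} =
      (Z -` E \<inter> space M) \<inter> (?V -` (\<Pi>\<^sub>E i\<in>K. G i) \<inter> space M)"
  proof (rule set_eqI)
    fix \<omega>
    show "\<omega> \<in> {\<omega>\<in>space M. Z \<omega> \<in> E \<and> hits A J K \<theta> \<omega> = m} \<longleftrightarrow>
        \<omega> \<in> (Z -` E \<inter> space M) \<inter> (?V -` (\<Pi>\<^sub>E i\<in>K. G i) \<inter> space M)"
      by (cases "\<omega> \<in> space M") (simp_all add: hits PiE_iff)
  qed
  have "prob {\<omega>\<in>space M. Z \<omega> \<in> E \<and> hits A J K \<theta> \<omega> = m} =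
      prob (Z -` E \<inter> space M) * prob (?V -` (\<Pi>\<^sub>E i\<in>K. G i) \<inter> space M)"
    unfolding eq
    using Z E G fin by (intro indep_setD) (auto simp: indep_rv_def intro!: in_vimage_algebra)
  also have "?V -` (\<Pi>\<^sub>E i\<in>K. G i) \<inter> space M = (\<Inter>i\<in>K. \<theta> i -` G i \<inter> space M)"
    using \<open>K \<noteq> {}\<close> by (auto simp: PiE_iff)
  also have "prob \<dots> = (\<Prod>i\<in>K. prob (\<theta> i -` G i \<inter> space M))"
    using fin indep G by (intro indep_varsD_finite) auto
  also have "\<dots> = (\<Prod>i\<in>K. c)"
  proof (rule prod.cong)
    fix i assume i: "i \<in> K"
    have "\<theta> i -` G i \<inter> space M = {\<omega>\<in>space M. \<forall>j\<in>J. \<theta> i \<omega> \<in> A j \<longleftrightarrow> (j, i) \<in> m}"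
      using rv[OF i] by (auto simp: G_def)
    then show "prob (\<theta> i -` G i \<inter> space M) = c"
      using c[OF i] by simp
  qed simp
  also have "Z -` E \<inter> space M = {\<omega>\<in>space M. Z \<omega> \<in> E}"
    by auto
  finally show ?thesis
    by simp
qed

text \<open>An event of the history restricts \<open>Z\<close> to a section that varies with the
  answers, hence the set \<open>R\<close> depending on \<open>D\<close>. Splitting by the finitely
  many values of \<open>D\<close> fixes the section.\<close>

lemma (in prob_space) expectation_finite_mixture:
  fixes \<phi> :: "'m \<Rightarrow> real"
  assumes "finite \<D>"
    and Z[measurable]: "Z \<in> measurable M T" and D[measurable]: "D \<in> measurable M (count_space \<D>)"
    and R: "\<And>m. m \<in> \<D> \<Longrightarrow> R m \<in> sets T"
  shows "expectation (\<lambda>\<omega>. indicator (R (D \<omega>)) (Z \<omega>) * \<phi> (D \<omega>)) =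
    (\<Sum>m\<in>\<D>. prob {\<omega>\<in>space M. Z \<omega> \<in> R m \<and> D \<omega> = m} * \<phi> m)"
proof -
  define V where "V m = {\<omega>\<in>space M. Z \<omega> \<in> R m \<and> D \<omega> = m}" for m
  have V: "V m \<in> events" if "m \<in> \<D>" for m
    unfolding V_def using R[OF that] by measurable
  have "expectation (\<lambda>\<omega>. indicator (R (D \<omega>)) (Z \<omega>) * \<phi> (D \<omega>)) =
      expectation (\<lambda>\<omega>. \<Sum>m\<in>\<D>. indicator (V m) \<omega> * \<phi> m)"
  proof (rule Bochner_Integration.integral_cong[OF refl])
    fix \<omega> assume \<omega>: "\<omega> \<in> space M"
    then have "D \<omega> \<in> \<D>"
      using measurable_space[OF D] by simp
    moreover have "indicator (V m) \<omega> * \<phi> m =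
        (if m = D \<omega> then indicator (R (D \<omega>)) (Z \<omega>) * \<phi> (D \<omega>) else 0)" for m
      using \<omega> by (auto simp: V_def indicator_def)
    ultimately show "indicator (R (D \<omega>)) (Z \<omega>) * \<phi> (D \<omega>) = (\<Sum>m\<in>\<D>. indicator (V m) \<omega> * \<phi> m)"
      using \<open>finite \<D>\<close> by simp
  qed
  also have "\<dots> = (\<Sum>m\<in>\<D>. prob (V m) * \<phi> m)"
    using V by (subst Bochner_Integration.integral_sum) (auto simp: emeasure_eq_measure)
  finally show ?thesis
    by (simp add: V_def)
qed

lemma answer_eq_card: "answer \<theta> k A j \<omega> = card {i\<in>{1..k}. \<theta> i \<omega> \<in> A j}"
  by (simp add: answer_def indicator_def of_bool_def sum.If_cases Int_def)

section \<open>Conditioning on the history\<close>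

theorem lemma3:
  fixes M :: "'a measure"
    and \<theta> :: "nat \<Rightarrow> 'a \<Rightarrow> real"
    and Z :: "'a \<Rightarrow> real"
    and f0 :: "real \<Rightarrow> real"
    and k N :: nat
  defines "B \<equiv> history Z \<theta> k (dyadic_query f0) N"
    and "X \<equiv> answer \<theta> k (dyadic_query f0)"
  assumes "prob_space M"
    and "k \<ge> 1" and "N \<ge> 1"
    and "prob_space.indep_vars M (\<lambda>_. borel) \<theta> {1..k}"
    and "\<And>i. i \<in> {1..k} \<Longrightarrow> information_space.finite_entropy M 2 lborel (\<theta> i) f0"
    and "distributed M lborel Z (\<lambda>x. indicator {0..1} x / measure lborel {0..1::real})"
    and "indep_rv M borel Z (Pi\<^sub>M {1..k} (\<lambda>_. borel)) (\<lambda>\<omega>. \<lambda>i\<in>{1..k}. \<theta> i \<omega>)"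
  shows "\<forall>s \<in> {1..N} \<rightarrow>\<^sub>E {0, 1}.
    (\<forall>i\<in>{1..k}. AE \<omega> in M.
       cond_prob_given M (history_space N) B {\<omega>\<in>space M. \<theta> i \<omega> \<in> cell f0 N s} \<omega> =
       (\<Prod>j\<in>{1..N}. (real (X j \<omega>) / real k) ^ s j * (1 - real (X j \<omega>) / real k) ^ (1 - s j))) \<and>
    (AE \<omega> in M.
       cond_expect_given M (history_space N) B
         (\<lambda>\<omega>. real (num_objects \<theta> k (cell f0 N s) \<omega>)) \<omega> =
       real k * cond_prob_given M (history_space N) B {\<omega>\<in>space M. \<theta> 1 \<omega> \<in> cell f0 N s} \<omega>)"
proof -
  interpret information_space M 2
    using assms(3) by (simp add: information_space_def information_space_axioms_def)
  define J where "J = {1..N}"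
  define K where "K = {1..k}"
  define A where "A = dyadic_query f0"
  define D where "D = hits A J K \<theta>"
  define x where "x m = (\<lambda>j\<in>J. card {i\<in>K. (j, i) \<in> m})" for m
  define F where "F = vimage_algebra (space M) B (history_space N)"
  have J: "finite J" and K: "finite K" "K \<noteq> {}" and cardK: "card K = k"
    using \<open>k \<ge> 1\<close> by (auto simp: J_def K_def)
  have fe: "finite_entropy lborel (\<theta> i) f0" if "i \<in> K" for i
    using assms(7) that by (simp add: K_def)
  have dist: "distributed M lborel (\<theta> i) f0" if "i \<in> K" for i
    using fe[OF that] by (rule finite_entropy_distributed)
  have f0[measurable]: "f0 \<in> borel_measurable borel"
    using finite_entropy_measurable[OF fe] K by auto
  have \<theta>[measurable]: "\<theta> i \<in> borel_measurable M" if "i \<in> K" for i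
    using distributed_measurable[OF dist[OF that]] by simp
  have law: "distr M borel (\<theta> i) = density lborel f0" if "i \<in> K" for i
    using distributed_distr_eq_density[OF dist[OF that]] by (simp cong: distr_cong)
  have real_dist: "real_distribution (density lborel f0)"
    using law \<theta> K real_distribution_distr by (metis ex_in_conv)
  have A[measurable]: "A j \<in> sets borel" for j
    unfolding A_def by (rule borel_dyadic_query) measurable
  have cell_borel[measurable]: "cell f0 N s \<in> sets borel" for s
  proof -
    have "{u. f0 u > 0} \<in> sets borel"
      by measurable
    then show ?thesis
      using A unfolding cell_def A_def support_def
      by (intro sets.Int) (auto intro!: sets.countable_INT'')
  qed
  have Z[measurable]: "Z \<in> borel_measurable M"
    using distributed_measurable[OF assms(8)] by simp
  have D[measurable]: "D \<in> measurable M (count_space (Pow (J \<times> K)))"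
    unfolding D_def by (rule measurable_hits[where S = borel]) (use J K \<theta> A in auto)
  have pattern: "prob {\<omega>\<in>space M. \<forall>j\<in>J. \<theta> i \<omega> \<in> A j \<longleftrightarrow> d j} = 1 / 2 ^ N" if i: "i \<in> K" for i d
  proof -
    have "{u \<in> space borel. \<forall>j\<in>J. u \<in> A j \<longleftrightarrow> d j} \<in> sets borel"
      using J by measurable
    then have "prob (\<theta> i -` {u. \<forall>j\<in>J. u \<in> A j \<longleftrightarrow> d j} \<inter> space M) =
        measure (distr M borel (\<theta> i)) {u. \<forall>j\<in>J. u \<in> A j \<longleftrightarrow> d j}"
      using \<theta>[OF i] by (simp add: measure_distr)
    also have "\<dots> = 1 / 2 ^ N"
      unfolding law[OF i] J_def A_def using real_dist f0 by (rule measure_dyadic_pattern)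
    finally show ?thesis
      by (simp add: vimage_def Int_def conj_commute)
  qed
  have X: "X j \<omega> = card {i\<in>K. (j, i) \<in> D \<omega>}" if "j \<in> J" for j \<omega>
    using that by (auto simp: X_def answer_eq_card D_def hits_def A_def K_def intro!: arg_cong[where f = card])
  \<comment> \<open>The history sees the relation only through its row counts, which is what the
    averaging identity requires of its weight.\<close>
  have B: "B \<omega> = (Z \<omega>, restrict A J, x (D \<omega>))" for \<omega>
    using X by (auto simp: B_def history_def x_def X_def A_def J_def)
  have xspace: "x m \<in> space (Pi\<^sub>M J (\<lambda>_. count_space UNIV))" for m
    by (simp add: x_def space_PiM)
  have Aspace: "restrict A J \<in> space (Pi\<^sub>M J (\<lambda>_. count_space UNIV))"
    by (simp add: space_PiM)
  have B_meas[measurable]: "B \<in> measurable M (history_space N)"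
  proof -
    have "(\<lambda>\<omega>. x (D \<omega>)) \<in> measurable M (Pi\<^sub>M J (\<lambda>_. count_space UNIV))"
      using xspace by (intro measurable_compose[OF D]) simp
    then show ?thesis
      unfolding B[abs_def] history_space_def J_def[symmetric] using Aspace by measurable
  qed
  have "subalgebra M F"
    using sets_image_in_sets[OF refl B_meas] by (simp add: subalgebra_def F_def)
  then interpret finite_measure_subalgebra M F
    by unfold_locales
  have slice: "{z. (z, restrict A J, x m) \<in> S} \<in> sets borel" if "S \<in> sets (history_space N)" for S m
  proof -
    have "(\<lambda>z. (z, restrict A J, x m)) \<in> measurable borel (history_space N)"
      unfolding history_space_def J_def[symmetric] using xspace Aspace by measurable
    from measurable_sets[OF this that] show ?thesis
      by (simp add: vimage_def)
  qed
  show ?thesis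
  proof (intro ballI conjI)
    fix s :: "nat \<Rightarrow> nat" assume "s \<in> {1..N} \<rightarrow>\<^sub>E {0, 1}"
    then have s: "s j = 0 \<or> s j = 1" if "j \<in> J" for j
      using that by (auto simp: J_def PiE_iff)
    define P where "P \<omega> = (\<Prod>j\<in>J. (real (X j \<omega>) / real k) ^ s j * (1 - real (X j \<omega>) / real k) ^ (1 - s j))" for \<omega>
    \<comment> \<open>As functions of the relation, \<open>\<psi>\<close> is the claimed product and
      \<open>\<phi> i\<close> is, up to a null set, the indicator of the cell: the two integrands of
      \<open>sum_Pow_row_average\<close>.\<close>
    define \<psi> where "\<psi> m = (\<Prod>j\<in>J. (\<Sum>i'\<in>K. of_bool ((j, i') \<in> m \<longleftrightarrow> s j = 1)) / real (card K))" for m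
    define \<phi> where "\<phi> i m = (\<Prod>j\<in>J. of_bool ((j, i) \<in> m \<longleftrightarrow> s j = 1) :: real)" for i :: nat and m
    let ?H = "\<lambda>i. {\<omega>\<in>space M. \<theta> i \<omega> \<in> cell f0 N s}"
    have P: "P \<omega> = \<psi> (D \<omega>)" for \<omega>
      unfolding P_def \<psi>_def
    proof (rule prod.cong)
      fix j assume j: "j \<in> J"
      let ?n = "card {i\<in>K. (j, i) \<in> D \<omega>}"
      have "(\<Sum>i'\<in>K. of_bool ((j, i') \<in> D \<omega>)) = real ?n"
        using K by (simp add: Int_def)
      moreover have "(\<Sum>i'\<in>K. of_bool ((j, i') \<notin> D \<omega>)) = real k - real ?n"
        using K calculation by (simp add: of_bool_not_iff sum_subtractf cardK)
      ultimately show "(real (X j \<omega>) / real k) ^ s j * (1 - real (X j \<omega>) / real k) ^ (1 - s j) =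
          (\<Sum>i'\<in>K. of_bool ((j, i') \<in> D \<omega> \<longleftrightarrow> s j = 1)) / real (card K)"
        using s[OF j] \<open>k \<ge> 1\<close> by (auto simp: X[OF j] cardK diff_divide_distrib)
    qed simp
    have P_meas: "P \<in> borel_measurable F"
    proof -
      have "(\<lambda>\<omega>. real (snd (snd (B \<omega>)) j)) \<in> borel_measurable F" if j: "j \<in> J" for j
      proof -
        have B_F: "B \<in> measurable F (history_space N)"
          unfolding F_def using measurable_space[OF B_meas] by (intro measurable_vimage_algebra1) auto
        have "(\<lambda>b. real (snd (snd b) j)) \<in> borel_measurable (history_space N)"
          unfolding history_space_def J_def[symmetric] using j by measurable
        then show ?thesis
          by (rule measurable_compose[OF B_F])
      qed
      moreover have "snd (snd (B \<omega>)) j = X j \<omega>" if "j \<in> J" for j \<omega>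
        using that by (simp add: B x_def X)
      ultimately have [measurable]: "(\<lambda>\<omega>. real (X j \<omega>)) \<in> borel_measurable F" if "j \<in> J" for j
        using that by simp
      show ?thesis
        unfolding P_def[abs_def] by measurable
    qed
    have \<psi>_bound: "\<bar>\<psi> m\<bar> \<le> 1" for m
      unfolding \<psi>_def abs_prod
    proof (rule prod_le_1)
      fix j
      have "(\<Sum>i'\<in>K. of_bool ((j, i') \<in> m \<longleftrightarrow> s j = 1) :: real) \<le> (\<Sum>i'\<in>K. 1)"
        by (rule sum_mono) simp
      then show "0 \<le> \<bar>(\<Sum>i'\<in>K. of_bool ((j, i') \<in> m \<longleftrightarrow> s j = 1)) / real (card K)\<bar> \<and>
          \<bar>(\<Sum>i'\<in>K. of_bool ((j, i') \<in> m \<longleftrightarrow> s j = 1)) / real (card K)\<bar> \<le> 1"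
        using K by (simp add: sum_nonneg field_simps card_gt_0_iff)
    qed
    have P_int: "integrable M P"
      using measurable_from_subalg[OF subalg P_meas] P \<psi>_bound
      by (intro integrable_const_bound[where B = 1]) auto
    have H[measurable]: "?H i \<in> events" if "i \<in> K" for i
      using \<theta>[OF that] by measurable
    have cond: "AE \<omega> in M. real_cond_exp M F (indicator (?H i)) \<omega> = P \<omega>" if i: "i \<in> K" for i
    proof (rule real_cond_exp_charact)
      show "integrable M (indicator (?H i) :: 'a \<Rightarrow> real)"
        using H[OF i] by (simp add: emeasure_eq_measure)
      \<comment> \<open>The cell also demands membership in the support, so its indicator agrees
        with the digit pattern only almost surely.\<close>
      have "AE u in distr M borel (\<theta> i). f0 u > 0"
        unfolding law[OF i] by (subst AE_density) auto
      then have "AE \<omega> in M. f0 (\<theta> i \<omega>) > 0"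
        using AE_distrD \<theta>[OF i] by blast
      then have ind: "AE \<omega> in M. indicator (?H i) \<omega> = \<phi> i (D \<omega>)"
        using AE_space
      proof eventually_elim
        case (elim \<omega>)
        have "\<omega> \<in> ?H i \<longleftrightarrow> (\<forall>j\<in>J. (j, i) \<in> D \<omega> \<longleftrightarrow> s j = 1)"
          using elim i s by (fastforce simp: cell_def support_def D_def hits_def A_def J_def)
        then show ?case
          using J by (auto simp: \<phi>_def indicator_def)
      qed
      fix U assume "U \<in> sets F"
      then obtain S where S: "S \<in> sets (history_space N)" and U: "U = B -` S \<inter> space M"
        using measurable_space[OF B_meas] by (auto simp: F_def sets_vimage_algebra2)
      define R where "R y = {z. (z, restrict A J, y) \<in> S}" for y
      \<comment> \<open>The joint probability of \<open>Z\<close> lying in the section at answers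
        \<open>y\<close> and of any one relation with these answers.\<close>
      define w where "w y = prob {\<omega>\<in>space M. Z \<omega> \<in> R y} * (1 / 2 ^ N) ^ card K" for y
      have U_ind: "indicator U \<omega> = (indicator (R (x (D \<omega>))) (Z \<omega>) :: real)" if "\<omega> \<in> space M" for \<omega>
        using that by (simp add: U B R_def indicator_def)
      have R: "R (x m) \<in> sets borel" for m
        using slice[OF S] by (simp add: R_def)
      have mix: "expectation (\<lambda>\<omega>. indicator (R (x (D \<omega>))) (Z \<omega>) * g (D \<omega>)) =
          (\<Sum>m\<in>Pow (J \<times> K). w (x m) * g m)" for g
      proof -
        have "prob {\<omega>\<in>space M. Z \<omega> \<in> R (x m) \<and> D \<omega> = m} = w (x m)" if "m \<in> Pow (J \<times> K)" for m
          unfolding w_def D_def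
          by (rule prob_indep_hits[where S = borel and T = borel])
            (use J K A R pattern assms(6,9) that in \<open>auto simp: K_def\<close>)
        then show ?thesis
          using J K R by (subst expectation_finite_mixture[where T = borel and \<D> = "Pow (J \<times> K)"]) auto
      qed
      have "(\<integral>\<omega>\<in>U. indicator (?H i) \<omega> \<partial>M) =
          expectation (\<lambda>\<omega>. indicator (R (x (D \<omega>))) (Z \<omega>) * \<phi> i (D \<omega>))"
      proof -
        have [measurable]: "U \<in> events"
          using \<open>U \<in> sets F\<close> subalg by (auto simp: subalgebra_def)
        have U_meas: "(\<lambda>\<omega>. indicator (R (x (D \<omega>))) (Z \<omega>) :: real) \<in> borel_measurable M"
          by (subst measurable_cong[OF U_ind[symmetric]]) auto
        have "(\<lambda>\<omega>. \<phi> i (D \<omega>)) \<in> borel_measurable M"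
          by (rule measurable_compose[OF D]) simp
        then show ?thesis
          unfolding set_lebesgue_integral_def using ind H[OF i] U_meas
          by (intro integral_cong_AE) (auto simp: U_ind)
      qed
      also have "\<dots> = (\<Sum>m\<in>Pow (J \<times> K). w (x m) * \<phi> i m)"
        by (rule mix)
      \<comment> \<open>The exchange argument: under a weight depending only on row counts, the
        digits of object \<open>i\<close> may be replaced by the row proportions.\<close>
      also have "\<dots> = (\<Sum>m\<in>Pow (J \<times> K). w (x m) * \<psi> m)"
        unfolding \<phi>_def \<psi>_def x_def using J K(1) i by (rule sum_Pow_row_average)
      also have "\<dots> = expectation (\<lambda>\<omega>. indicator (R (x (D \<omega>))) (Z \<omega>) * \<psi> (D \<omega>))"
        by (rule mix[symmetric])
      also have "\<dots> = (\<integral>\<omega>\<in>U. P \<omega> \<partial>M)"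
        unfolding set_lebesgue_integral_def
        by (intro Bochner_Integration.integral_cong) (auto simp: U_ind P)
      finally show "(\<integral>\<omega>\<in>U. indicator (?H i) \<omega> \<partial>M) = (\<integral>\<omega>\<in>U. P \<omega> \<partial>M)" .
    qed (use P_int P_meas in auto)
    show "AE \<omega> in M. cond_prob_given M (history_space N) B (?H i) \<omega> =
        (\<Prod>j\<in>{1..N}. (real (X j \<omega>) / real k) ^ s j * (1 - real (X j \<omega>) / real k) ^ (1 - s j))"
      if "i \<in> {1..k}" for i
      using cond[of i] that
      by (simp add: cond_prob_given_def cond_expect_given_def F_def K_def P_def J_def)
    have count: "AE \<omega> in M. real (num_objects \<theta> k (cell f0 N s) \<omega>) = (\<Sum>i\<in>K. indicator (?H i) \<omega>)"
      using AE_space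
      by eventually_elim (simp add: num_objects_def K_def indicator_def of_bool_def sum.If_cases Int_def)
    have "AE \<omega> in M. real_cond_exp M F (\<lambda>\<omega>. real (num_objects \<theta> k (cell f0 N s) \<omega>)) \<omega> =
        real_cond_exp M F (\<lambda>\<omega>. \<Sum>i\<in>K. indicator (?H i) \<omega>) \<omega>"
    proof (rule real_cond_exp_cong[OF count])
      show "(\<lambda>\<omega>. \<Sum>i\<in>K. indicator (?H i) \<omega> :: real) \<in> borel_measurable M"
        using H by (intro borel_measurable_sum) auto
      then show "(\<lambda>\<omega>. real (num_objects \<theta> k (cell f0 N s) \<omega>)) \<in> borel_measurable M"
        by (rule measurable_cong[THEN iffD1, rotated])
          (simp add: num_objects_def K_def indicator_def of_bool_def sum.If_cases Int_def)
    qed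
    moreover have "AE \<omega> in M. real_cond_exp M F (\<lambda>\<omega>. \<Sum>i\<in>K. indicator (?H i) \<omega>) \<omega> =
        (\<Sum>i\<in>K. real_cond_exp M F (indicator (?H i)) \<omega>)"
      \<comment> \<open>Linearity asks for integrability at every index, so the family is extended
        by zero outside \<open>K\<close>.\<close>
      using real_cond_exp_sum[of "\<lambda>i. if i \<in> K then indicator (?H i) else (\<lambda>_. 0)" K] H
      by (simp add: emeasure_eq_measure cong: if_cong sum.cong)
    \<comment> \<open>The value \<open>P\<close> is the same for all objects, so the sum consists of
      \<open>k\<close> equal terms.\<close>
    moreover have "AE \<omega> in M. \<forall>i\<in>K. real_cond_exp M F (indicator (?H i)) \<omega> = P \<omega>"
      using cond K by (intro AE_finite_allI) auto
    ultimately have "AE \<omega> in M. real_cond_exp M F (\<lambda>\<omega>. real (num_objects \<theta> k (cell f0 N s) \<omega>)) \<omega> =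
        real k * real_cond_exp M F (indicator (?H 1)) \<omega>"
    proof eventually_elim
      case (elim \<omega>)
      have "1 \<in> K"
        using \<open>k \<ge> 1\<close> by (simp add: K_def)
      with elim show ?case
        by (simp add: cardK)
    qed
    then show "AE \<omega> in M. cond_expect_given M (history_space N) B
         (\<lambda>\<omega>. real (num_objects \<theta> k (cell f0 N s) \<omega>)) \<omega> =
       real k * cond_prob_given M (history_space N) B {\<omega>\<in>space M. \<theta> 1 \<omega> \<in> cell f0 N s} \<omega>"
      by (simp add: cond_prob_given_def cond_expect_given_def F_def)
  qed
qed

end
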